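(* Let $n, m$ be positive integers and let $f : \mathbb{Z}^{n+m} \to \mathbb{R} \cup \{+\infty\}$ be a locally discrete midpoint convex function. Let $g$ be the projection of $f$ to $\mathbb{Z}^{n}$, i.e., $g(x) = \inf\{ f(x,y) \mid y \in \mathbb{Z}^{m} \}$ for $x \in \mathbb{Z}^{n}$, and assume that $g(x) > -\infty$ for all $x \in \mathbb{Z}^{n}$. Then $g : \mathbb{Z}^{n} \to \mathbb{R} \cup \{+\infty\}$ is a locally discrete midpoint convex function.
   Context: For a real vector $x$, $\lceil x \rceil$ and $\lfloor x \rfloor$ denote componentwise rounding-up and rounding-down to the nearest integers. A set $S \subseteq \mathbb{Z}^{d}$ is discrete midpoint convex if $x, y \in S$ and $\|x-y\|_{\infty} \ge 2$ imply $\lceil (x+y)/2 \rceil \in S$ and $\lfloor (x+y)/2 \rfloor \in S$. For $f : \mathbb{Z}^{d} \to \mathbb{R} \cup \{+\infty\}$, the effective domain is $\mathrm{dom}\, f = \{ x \in \mathbb{Z}^{d} \mid f(x) < +\infty \}$. The function $f$ is locally discrete midpoint convex if $\mathrm{dom}\, f$ is a discrete midpoint convex set and $$ f(x) + f(y) \ge f\left( \left\lceil \frac{x+y}{2} \right\rceil \right) + f\left( \left\lfloor \frac{x+y}{2} \right\rfloor \right) $$ holds for every pair $(x,y) \in \mathbb{Z}^{d} \times \mathbb{Z}^{d}$ with $\|x-y\|_{\infty} = 2$ (exactly equal to two). *)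

theory Defs
  imports "HOL-Analysis.Analysis"
begin

definition real_vec :: "int ^ 'd \<Rightarrow> real ^ 'd::finite"
  where "real_vec x = (\<chi> i. real_of_int (x $ i))"

definition ceil_vec :: "real ^ 'd \<Rightarrow> int ^ 'd::finite"
  where "ceil_vec v = (\<chi> i. \<lceil>v $ i\<rceil>)"

definition floor_vec :: "real ^ 'd \<Rightarrow> int ^ 'd::finite"
  where "floor_vec v = (\<chi> i. \<lfloor>v $ i\<rfloor>)"

definition linf_dist :: "int ^ 'd::finite \<Rightarrow> int ^ 'd \<Rightarrow> real"
  where "linf_dist x y = infnorm (real_vec x - real_vec y)"

definition midpoint_ceil :: "int ^ 'd::finite \<Rightarrow> int ^ 'd \<Rightarrow> int ^ 'd"
  where "midpoint_ceil x y = ceil_vec (midpoint (real_vec x) (real_vec y))"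

definition midpoint_floor :: "int ^ 'd::finite \<Rightarrow> int ^ 'd \<Rightarrow> int ^ 'd"
  where "midpoint_floor x y = floor_vec (midpoint (real_vec x) (real_vec y))"

definition discrete_midpoint_convex_set :: "(int ^ 'd::finite) set \<Rightarrow> bool"
  where "discrete_midpoint_convex_set S \<longleftrightarrow>
    (\<forall>x\<in>S. \<forall>y\<in>S. linf_dist x y \<ge> 2 \<longrightarrow> midpoint_ceil x y \<in> S \<and> midpoint_floor x y \<in> S)"

definition effective_dom :: "(int ^ 'd::finite \<Rightarrow> ereal) \<Rightarrow> (int ^ 'd) set"
  where "effective_dom f = {x. f x < \<infinity>}"

text \<open>
  Functions with values in the reals extended by \<open>+\<infinity>\<close> only are represented as
  \<open>ereal\<close>-valued functions that avoid \<open>-\<infinity>\<close>; this typing condition is the first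
  conjunct below.
\<close>

definition locally_discrete_midpoint_convex :: "(int ^ 'd::finite \<Rightarrow> ereal) \<Rightarrow> bool"
  where "locally_discrete_midpoint_convex f \<longleftrightarrow>
    (\<forall>x. f x \<noteq> -\<infinity>) \<and>
    discrete_midpoint_convex_set (effective_dom f) \<and>
    (\<forall>x y. linf_dist x y = 2 \<longrightarrow> f x + f y \<ge> f (midpoint_ceil x y) + f (midpoint_floor x y))"

text \<open>
  Vectors of dimension \<open>n + m\<close> are indexed by the sum type \<open>'n + 'm\<close>;
  \<open>vec_pair x y\<close> is the concatenation \<open>(x, y)\<close>.
\<close>

definition vec_pair :: "int ^ 'n::finite \<Rightarrow> int ^ 'm::finite \<Rightarrow> int ^ ('n + 'm)"
  where "vec_pair x y = (\<chi> k. case k of Inl i \<Rightarrow> x $ i | Inr j \<Rightarrow> y $ j)"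

definition projection :: "(int ^ ('n::finite + 'm::finite) \<Rightarrow> ereal) \<Rightarrow> int ^ 'n \<Rightarrow> ereal"
  where "projection f x = (INF y. f (vec_pair x y))"

end

theory Submission
  imports Defs
begin

text \<open>
  Let \<open>u\<close>, \<open>v\<close> be points of the effective domain at distance \<open>m \<ge> 3\<close> and let \<open>d\<close> be \<open>1\<close> where
  \<open>v - u \<ge> 1\<close>, \<open>-1\<close> where \<open>v - u = -m\<close>, and \<open>0\<close> elsewhere. Replacing \<open>(u, v)\<close> by \<open>(u + d, v - d)\<close>
  keeps the sum, decreases the distance, and does not increase \<open>f u + f v\<close>. Given two points over
  \<open>x\<close> and \<open>y\<close> with \<open>x\<close>, \<open>y\<close> at distance two, these exchanges are repeated until the total distance
  is at most two. If it is then two, the local inequality applies to the final pair, and its midpoints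
  lie over those of \<open>x\<close> and \<open>y\<close> because the sum was kept; if it is smaller, the final pair itself lies
  over the two midpoints.
\<close>

section \<open>Rounded midpoints and the maximum distance in integer coordinates\<close>

lemma midpoint_ceil_nth [simp]: "midpoint_ceil x y $ i = (x $ i + y $ i + 1) div 2"
proof -
  have "\<lceil>(real_of_int (x $ i) + real_of_int (y $ i)) / 2\<rceil> = (x $ i + y $ i + 1) div 2"
    using ceiling_divide_eq_div [of "x $ i + y $ i" 2, where ?'a = real] by simp
  then show ?thesis
    by (simp add: midpoint_ceil_def ceil_vec_def real_vec_def midpoint_def)
qed

lemma midpoint_floor_nth [simp]: "midpoint_floor x y $ i = (x $ i + y $ i) div 2"
proof -
  have "\<lfloor>(real_of_int (x $ i) + real_of_int (y $ i)) / 2\<rfloor> = (x $ i + y $ i) div 2"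
    using floor_divide_of_int_eq [of "x $ i + y $ i" 2, where ?'a = real] by simp
  then show ?thesis
    by (simp add: midpoint_floor_def floor_vec_def real_vec_def midpoint_def)
qed

lemma linf_dist_le_iff: "linf_dist x y \<le> of_int c \<longleftrightarrow> (\<forall>i. \<bar>x $ i - y $ i\<bar> \<le> c)"
proof -
  have "linf_dist x y = (SUP i. \<bar>real_of_int (x $ i - y $ i)\<bar>)"
    by (simp add: linf_dist_def infnorm_cart real_vec_def full_SetCompr_eq)
  also have "\<dots> \<le> of_int c \<longleftrightarrow> (\<forall>i. \<bar>real_of_int (x $ i - y $ i)\<bar> \<le> of_int c)"
    by (subst cSUP_le_iff) (auto intro: bdd_above_finite)
  also have "\<dots> \<longleftrightarrow> (\<forall>i. \<bar>x $ i - y $ i\<bar> \<le> c)"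
    by (simp only: of_int_abs [symmetric] of_int_le_iff)
  finally show ?thesis .
qed

lemma linf_dist_ge_iff: "linf_dist x y \<ge> of_int c \<longleftrightarrow> (\<exists>i. \<bar>x $ i - y $ i\<bar> \<ge> c)"
proof -
  have "linf_dist x y = (SUP i. \<bar>real_of_int (x $ i - y $ i)\<bar>)"
    by (simp add: linf_dist_def infnorm_cart real_vec_def full_SetCompr_eq)
  also have "\<dots> = Max (range (\<lambda>i. \<bar>real_of_int (x $ i - y $ i)\<bar>))"
    by (rule cSup_eq_Max) auto
  also have "\<dots> \<ge> of_int c \<longleftrightarrow> (\<exists>i. \<bar>real_of_int (x $ i - y $ i)\<bar> \<ge> of_int c)"
    by (subst Max_ge_iff) auto
  also have "\<dots> \<longleftrightarrow> (\<exists>i. \<bar>x $ i - y $ i\<bar> \<ge> c)"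
    by (simp only: of_int_abs [symmetric] of_int_le_iff)
  finally show ?thesis .
qed

lemma linf_dist_ge_2_iff: "linf_dist x y \<ge> 2 \<longleftrightarrow> (\<exists>i. \<bar>x $ i - y $ i\<bar> \<ge> 2)"
  using linf_dist_ge_iff [of 2 x y] by simp

lemma linf_dist_eq_2_iff:
  "linf_dist x y = 2 \<longleftrightarrow> (\<forall>i. \<bar>x $ i - y $ i\<bar> \<le> 2) \<and> (\<exists>i. \<bar>x $ i - y $ i\<bar> \<ge> 2)"
  using linf_dist_ge_iff [of 2 x y] linf_dist_le_iff [of x y 2] by auto

lemma discrete_midpoint_convex_setD:
  assumes "discrete_midpoint_convex_set S" "x \<in> S" "y \<in> S" "\<bar>x $ i - y $ i\<bar> \<ge> 2"
  shows "midpoint_ceil x y \<in> S" "midpoint_floor x y \<in> S"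
  using assms unfolding discrete_midpoint_convex_set_def linf_dist_ge_2_iff by blast+

text \<open>Negation swaps rounding up and rounding down, so the two midpoints trade places. This
  supplies mirrored versions of membership results.\<close>

lemma discrete_midpoint_convex_set_uminus:
  assumes "discrete_midpoint_convex_set S"
  shows "discrete_midpoint_convex_set (uminus ` S)"
  unfolding discrete_midpoint_convex_set_def
proof (intro ballI impI)
  fix x y assume "x \<in> uminus ` S" "y \<in> uminus ` S" and far: "linf_dist x y \<ge> 2"
  then have S: "- x \<in> S" "- y \<in> S" by auto
  obtain i where "\<bar>x $ i - y $ i\<bar> \<ge> 2"
    using far linf_dist_ge_2_iff by blast
  then have "\<bar>(- x) $ i - (- y) $ i\<bar> \<ge> 2" by simp
  note mid = discrete_midpoint_convex_setD [OF assms S this]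
  have "midpoint_ceil x y = - midpoint_floor (- x) (- y)"
    "midpoint_floor x y = - midpoint_ceil (- x) (- y)"
    by (simp_all add: vec_eq_iff) linarith+
  with mid show "midpoint_ceil x y \<in> uminus ` S \<and> midpoint_floor x y \<in> uminus ` S"
    by simp
qed

section \<open>The exchange step inside a discrete midpoint convex set\<close>

definition step :: "int \<Rightarrow> int ^ 'd \<Rightarrow> int ^ 'd \<Rightarrow> int ^ 'd::finite"
  where "step m u v = (\<chi> i. if v $ i - u $ i \<ge> 1 then 1 else if v $ i - u $ i \<le> - m then - 1 else 0)"

lemma step_nth [simp]:
  "step m u v $ i = (if v $ i - u $ i \<ge> 1 then 1 else if v $ i - u $ i \<le> - m then - 1 else 0)"
  by (simp add: step_def)

definition at_dist :: "nat \<Rightarrow> int ^ 'd \<Rightarrow> int ^ 'd::finite \<Rightarrow> bool"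
  where "at_dist m u v \<longleftrightarrow> (\<forall>i. \<bar>v $ i - u $ i\<bar> \<le> int m) \<and> (\<exists>i. \<bar>v $ i - u $ i\<bar> = int m)"

lemma at_dist_commute: "at_dist m u v \<longleftrightarrow> at_dist m v u"
  by (simp add: at_dist_def abs_minus_commute)

text \<open>Strong induction on \<open>m\<close>. The hypothesis, used for the rounded-down midpoint
  and \<open>u\<close>, gives a point of \<open>S\<close> next to \<open>u\<close>. If that point is
  at distance \<open>m - 1\<close> from \<open>v\<close> with the same step, the hypothesis applies
  a second time. An odd \<open>m\<close> attained with both signs is treated separately.
  \<open>S\<close> varies because the negated set is used too.\<close>

lemma diff_step_in_discrete_midpoint_convex_set:
  fixes S :: "(int ^ 'd::finite) set"
  assumes "discrete_midpoint_convex_set S" "u \<in> S" "v \<in> S" "1 \<le> m" "at_dist m u v"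
  shows "v - step (int m) u v \<in> S"
  using assms
proof (induction m arbitrary: S u v rule: less_induct)
  case (less m)
  show ?case
  proof (cases "m = 1")
    case True
    have "v - step (int m) u v = u"
      unfolding vec_eq_iff
    proof
      fix i
      have "\<bar>v $ i - u $ i\<bar> \<le> 1" using less.prems True by (simp add: at_dist_def)
      then show "(v - step (int m) u v) $ i = u $ i" using True by auto
    qed
    with less.prems show ?thesis by simp
  next
    case False
    with less.prems have m2: "m \<ge> 2" by simp
    txt \<open>
      With \<open>m'\<close> the distance from \<open>u\<close> to the rounded-down midpoint \<open>e\<close>, the induction hypothesis for
      \<open>e\<close> and \<open>u\<close> yields the following neighbour of \<open>u\<close>.
    \<close>
    define first where "first m' u v = (\<chi> i. u $ i +
        (if v $ i < u $ i then - 1 else if (v $ i - u $ i) div 2 \<ge> int m' then 1 else 0))"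
      for m' and u v :: "int ^ 'd"
    have first: "first m' u v $ i = u $ i +
        (if v $ i < u $ i then - 1 else if (v $ i - u $ i) div 2 \<ge> int m' then 1 else 0)" for m' u v i
      by (simp add: first_def)
    have first_in: "first (if \<exists>i. v $ i - u $ i = - int m then (m + 1) div 2 else m div 2) u v \<in> S"
      if S: "discrete_midpoint_convex_set S" "u \<in> S" "v \<in> S" and d: "at_dist m u v" for S :: "(int ^ 'd) set" and u v
    proof -
      define e where "e = midpoint_floor u v"
      \<comment> \<open>Rounding down sends \<open>- int m\<close> to a number of absolute value
        \<open>(m + 1) div 2\<close>; every other difference has a half of absolute value at most
        \<open>m div 2\<close>.\<close>
      define m' where "m' = (if \<exists>i. v $ i - u $ i = - int m then (m + 1) div 2 else m div 2)"
      obtain k where k: "\<bar>v $ k - u $ k\<bar> = int m" using d by (auto simp: at_dist_def)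
      have "e \<in> S"
        unfolding e_def using S m2 k
        by (intro discrete_midpoint_convex_setD(2) [where i = k]) auto
      have e: "e $ i = u $ i + (v $ i - u $ i) div 2" for i
        unfolding e_def by simp
      have "at_dist m' e u"
        unfolding at_dist_def
      proof
        have half_le: "\<bar>t div 2\<bar> \<le> (n + 1) div 2" "t \<noteq> - n \<Longrightarrow> \<bar>t div 2\<bar> \<le> n div 2"
          if "\<bar>t\<bar> \<le> n" for t n :: int
          using that by presburger+
        show "\<forall>i. \<bar>u $ i - e $ i\<bar> \<le> int m'"
        proof
          fix i
          have "\<bar>v $ i - u $ i\<bar> \<le> int m" using d by (simp add: at_dist_def)
          moreover have "int m' = (if \<exists>i. v $ i - u $ i = - int m then (int m + 1) div 2 else int m div 2)"
            by (simp add: m'_def zdiv_int add.commute)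
          ultimately show "\<bar>u $ i - e $ i\<bar> \<le> int m'"
            using half_le(1) half_le(2) unfolding e by (cases "\<exists>i. v $ i - u $ i = - int m") auto
        qed
        show "\<exists>i. \<bar>u $ i - e $ i\<bar> = int m'"
        proof (cases "\<exists>i. v $ i - u $ i = - int m")
          case True
          then obtain i where i: "v $ i - u $ i = - int m" by blast
          have "\<bar>u $ i - e $ i\<bar> = int m'"
            using True unfolding m'_def e i by simp
          then show ?thesis ..
        next
          case False
          then have "v $ k - u $ k = int m" using k by (metis abs_eq_iff abs_of_nat)
          then have "\<bar>u $ k - e $ k\<bar> = int m'"
            using False unfolding m'_def e by simp
          then show ?thesis ..
        qed
      qed
      moreover have "m' < m" "1 \<le> m'" using m2 by (auto simp: m'_def)
      ultimately have "u - step (int m') e u \<in> S"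
        using less.IH [OF _ S(1) \<open>e \<in> S\<close> S(2)] by blast
      \<comment> \<open>Rounding down keeps negative halves negative, so \<open>u - e\<close> is
        positive exactly where \<open>v < u\<close>.\<close>
      also have "u - step (int m') e u = first m' u v"
        unfolding vec_eq_iff step_nth e vector_minus_component first
      proof
        fix i
        show "u $ i - (if 1 \<le> u $ i - (u $ i + (v $ i - u $ i) div 2) then 1 else
            if u $ i - (u $ i + (v $ i - u $ i) div 2) \<le> - int m' then - 1 else 0) =
          u $ i + (if v $ i < u $ i then - 1 else if int m' \<le> (v $ i - u $ i) div 2 then 1 else 0)"
          using \<open>1 \<le> m'\<close> by (smt (verit) div_pos_neg_trivial div_neg_pos_less0 pos_imp_zdiv_nonneg_iff)
      qed
      finally show ?thesis by (simp only: m'_def)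
    qed
    \<comment> \<open>By \<open>c\<close>, either no difference equals \<open>m\<close>, or
      \<open>m'\<close> is \<open>m div 2\<close> and \<open>first\<close> moves all coordinates
      where it does. Hence \<open>p\<close> is at distance \<open>m - 1\<close> from
      \<open>v\<close>, and the step from \<open>p\<close> at that distance is unchanged.\<close>
    have easy: "v - step (int m) u v \<in> S"
      if S: "discrete_midpoint_convex_set S" "u \<in> S" "v \<in> S" and d: "at_dist m u v"
        and c: "(\<forall>i. v $ i - u $ i \<noteq> int m) \<or> (\<forall>i. v $ i - u $ i \<noteq> - int m) \<or> even m" for S :: "(int ^ 'd) set" and u v
    proof -
      define m' where "m' = (if \<exists>i. v $ i - u $ i = - int m then (m + 1) div 2 else m div 2)"
      define p where "p = first m' u v"
      note p = first [of m' u v, folded p_def]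
      have "p \<in> S" using first_in [OF S d] by (simp only: p_def m'_def)
      have m'1: "1 \<le> m'" using m2 by (auto simp: m'_def)
      have top: "p $ i = u $ i + 1" if "v $ i - u $ i = int m" for i
      proof -
        have "m' = m div 2" using c that unfolding m'_def by auto
        then show ?thesis using that by (auto simp: p)
      qed
      have "at_dist (m - 1) p v"
        unfolding at_dist_def
      proof
        show "\<forall>i. \<bar>v $ i - p $ i\<bar> \<le> int (m - 1)"
        proof
          fix i
          have "\<bar>v $ i - u $ i\<bar> \<le> int m" using d by (simp add: at_dist_def)
          then show "\<bar>v $ i - p $ i\<bar> \<le> int (m - 1)"
          proof (cases "v $ i - u $ i = int m")
            case True
            then show ?thesis using m2 top [of i] by simp
          next
            case False
            with \<open>\<bar>v $ i - u $ i\<bar> \<le> int m\<close> show ?thesis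
              using m2 m'1 p [of i] by (auto split: if_splits)
          qed
        qed
        obtain k where k: "\<bar>v $ k - u $ k\<bar> = int m" using d by (auto simp: at_dist_def)
        then have "\<bar>v $ k - p $ k\<bar> = int (m - 1)"
          using m2 top [of k] p [of k] by (cases "v $ k < u $ k") auto
        then show "\<exists>i. \<bar>v $ i - p $ i\<bar> = int (m - 1)" ..
      qed
      then have "v - step (int (m - 1)) p v \<in> S"
        using less.IH [OF _ S(1) \<open>p \<in> S\<close> S(3), of "m - 1"] m2 by linarith
      also have "v - step (int (m - 1)) p v = v - step (int m) u v"
        unfolding vec_eq_iff
      proof
        fix i
        show "(v - step (int (m - 1)) p v) $ i = (v - step (int m) u v) $ i"
          using m2 m'1 p [of i] by (auto split: if_splits)
      qed
      finally show ?thesis .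
    qed
    show ?thesis
    proof (cases "(\<forall>i. v $ i - u $ i \<noteq> int m) \<or> (\<forall>i. v $ i - u $ i \<noteq> - int m) \<or> even m")
      case True
      then show ?thesis using easy less.prems by blast
    next
      case False
      then obtain k k' where k: "v $ k - u $ k = int m" and k': "v $ k' - u $ k' = - int m"
        and odd: "odd m" by auto
      txt \<open>
        Here \<open>first\<close> does not move the coordinates where \<open>v - u = m\<close>, so it stays at distance \<open>m\<close> from
        \<open>v\<close>, but no coordinate difference to \<open>v\<close> equals \<open>-m\<close> any more and \<open>easy\<close> applies to it. The
        claim is then reached as a midpoint of points obtained in this way from \<open>S\<close> and from \<open>-S\<close>.
      \<close>
      have half: "(\<chi> i. u $ i + (if v $ i < u $ i then - 1 else 0)) \<in> S
          \<and> v - (\<chi> i. if v $ i > u $ i then 1 else 0) \<in> S"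
        if S: "discrete_midpoint_convex_set S" "u \<in> S" "v \<in> S" and d: "at_dist m u v"
          and k: "v $ k - u $ k = int m" and k': "v $ k' - u $ k' = - int m" for S :: "(int ^ 'd) set" and u v k k'
      proof -
        define b where "b = (\<chi> i. u $ i + (if v $ i < u $ i then - 1 else 0))"
        have b: "b $ i = u $ i + (if v $ i < u $ i then - 1 else 0)" for i
          by (simp add: b_def)
        have bound: "\<bar>v $ i - u $ i\<bar> \<le> int m" for i using d by (simp add: at_dist_def)
        have "b = first ((m + 1) div 2) u v"
          unfolding vec_eq_iff
        proof
          fix i
          have "(v $ i - u $ i) div 2 < int ((m + 1) div 2)"
            using bound [of i] odd by (auto elim!: oddE)
          then show "b $ i = first ((m + 1) div 2) u v $ i"
            by (simp add: b first)
        qed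
        moreover have "\<exists>i. v $ i - u $ i = - int m" using k' ..
        ultimately have "b \<in> S" using first_in [OF S d] by simp
        have "at_dist m b v"
          unfolding at_dist_def
        proof
          show "\<forall>i. \<bar>v $ i - b $ i\<bar> \<le> int m"
          proof
            fix i
            show "\<bar>v $ i - b $ i\<bar> \<le> int m" using bound [of i] by (auto simp: b)
          qed
          show "\<exists>i. \<bar>v $ i - b $ i\<bar> = int m" using k by (intro exI [of _ k]) (auto simp: b)
        qed
        moreover have small: "- int m < v $ i - b $ i" for i
          using bound [of i] m2 by (auto simp: b)
        ultimately have "v - step (int m) b v \<in> S"
          using easy [OF S(1) \<open>b \<in> S\<close> S(3)] by (metis less_irrefl)
        also have "v - step (int m) b v = v - (\<chi> i. if v $ i > u $ i then 1 else 0)"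
          unfolding vec_eq_iff
        proof
          fix i
          show "(v - step (int m) b v) $ i = (v - (\<chi> i. if v $ i > u $ i then 1 else 0)) $ i"
            using small [of i] b [of i] by (auto split: if_splits)
        qed
        finally show ?thesis using \<open>b \<in> S\<close> by (simp add: b_def)
      qed
      define b where "b = (\<chi> i. u $ i + (if v $ i < u $ i then - 1 else 0))"
      define x where "x = v - (\<chi> i. if v $ i > u $ i then 1 else 0)"
      define y where "y = v + (\<chi> i. if v $ i < u $ i then 1 else 0)"
      define z where "z = x - step (int (m - 1)) b x"
      have bx: "b \<in> S" "x \<in> S"
        using half [OF less.prems(1-3,5) k k'] by (simp_all add: b_def x_def)
      \<comment> \<open>Negation reverses the signs of the differences, so \<open>k\<close> and
        \<open>k'\<close> exchange roles.\<close>
      have "at_dist m (- u) (- v)" using less.prems(5) by (simp add: at_dist_def abs_minus_commute)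
      then have "- v - (\<chi> i. if (- v) $ i > (- u) $ i then 1 else 0) \<in> uminus ` S"
        using half [OF discrete_midpoint_convex_set_uminus [OF less.prems(1)], of "- u" "- v" k' k]
          less.prems(2,3) k k' by auto
      also have "- v - (\<chi> i. if (- v) $ i > (- u) $ i then 1 else 0) = - y"
        by (auto simp: vec_eq_iff y_def)
      finally have "y \<in> S" by auto
      have bound: "\<bar>v $ i - u $ i\<bar> \<le> int m" for i using less.prems by (simp add: at_dist_def)
      have "at_dist (m - 1) b x"
        unfolding at_dist_def
      proof
        show "\<forall>i. \<bar>x $ i - b $ i\<bar> \<le> int (m - 1)"
        proof
          fix i
          show "\<bar>x $ i - b $ i\<bar> \<le> int (m - 1)"
            using bound [of i] m2 by (auto simp: x_def b_def)
        qed
        show "\<exists>i. \<bar>x $ i - b $ i\<bar> = int (m - 1)"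
          using k m2 by (intro exI [of _ k]) (auto simp: x_def b_def)
      qed
      then have "z \<in> S"
        unfolding z_def using less.IH [OF _ less.prems(1) bx, of "m - 1"] m2 by linarith
      \<comment> \<open>Where \<open>v - u\<close> is at least 2, equal to 1, equal to 0, strictly
        between \<open>-m\<close> and 0, or equal to \<open>-m\<close>, \<open>z - v\<close> is -2,
        -1, 0, 0, 1 and \<open>y - v\<close> is 0, 0, 0, 1, 1. Half the sum, rounded down, is -1,
        -1, 0, 0, 1.\<close>
      have "v - step (int m) u v = midpoint_floor z y"
        unfolding vec_eq_iff
      proof
        fix i
        show "(v - step (int m) u v) $ i = midpoint_floor z y $ i"
          using bound [of i] m2 by (auto simp: z_def x_def b_def y_def)
      qed
      moreover have "midpoint_floor z y \<in> S"
        using less.prems(1) \<open>z \<in> S\<close> \<open>y \<in> S\<close>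
      proof (rule discrete_midpoint_convex_setD(2))
        show "2 \<le> \<bar>z $ k - y $ k\<bar>"
          using k m2 by (auto simp: z_def x_def b_def y_def)
      qed
      ultimately show ?thesis by simp
    qed
  qed
qed

section \<open>Function values under exchanges\<close>

lemma locally_discrete_midpoint_convexD:
  assumes "locally_discrete_midpoint_convex f" "\<forall>i. \<bar>x $ i - y $ i\<bar> \<le> 2" "\<bar>x $ k - y $ k\<bar> \<ge> 2"
  shows "f (midpoint_ceil x y) + f (midpoint_floor x y) \<le> f x + f y"
  using assms unfolding locally_discrete_midpoint_convex_def linf_dist_eq_2_iff by blast

text \<open>
  Induction on the distance: \<open>z\<close> is \<open>u\<close> moved towards \<open>v\<close> by the step that mirrors the one from \<open>v\<close>;
  \<open>(z, v)\<close> has the same step \<open>d\<close>, and \<open>u + d\<close> and \<open>z\<close> are the two midpoints of \<open>u\<close> and \<open>z + d\<close>.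
\<close>

lemma step_inequality:
  fixes f :: "int ^ 'd::finite \<Rightarrow> ereal"
  assumes f: "locally_discrete_midpoint_convex f"
    and "u \<in> effective_dom f" "v \<in> effective_dom f" "1 \<le> m" "at_dist m u v"
  shows "u + step (int m) u v \<in> effective_dom f \<and>
    f (u + step (int m) u v) + f (v - step (int m) u v) \<le> f u + f v"
  using assms(4,2,3,5)
proof (induction m arbitrary: u rule: nat_induct_at_least)
  case base
  \<comment> \<open>At distance one the exchange merely swaps the two points.\<close>
  have "step (int 1) u v = v - u"
    unfolding vec_eq_iff
  proof
    fix i
    have "\<bar>v $ i - u $ i\<bar> \<le> 1" using base by (simp add: at_dist_def)
    then show "step (int 1) u v $ i = (v - u) $ i" by auto
  qed
  with base show ?case by (simp add: add.commute)
next
  case (Suc m)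
  have S: "discrete_midpoint_convex_set (effective_dom f)"
    using f by (simp add: locally_discrete_midpoint_convex_def)
  define d where "d = step (int (Suc m)) u v"
  define z where "z = u - step (int (Suc m)) v u"
  have bound: "\<bar>v $ i - u $ i\<bar> \<le> 1 + int m" for i
    using Suc.prems by (simp add: at_dist_def)
  obtain k where k: "\<bar>v $ k - u $ k\<bar> = 1 + int m"
    using Suc.prems by (auto simp: at_dist_def)
  have z: "z \<in> effective_dom f" and vd: "v - d \<in> effective_dom f"
    using diff_step_in_discrete_midpoint_convex_set [OF S Suc.prems(2,1), of "Suc m"]
      diff_step_in_discrete_midpoint_convex_set [OF S Suc.prems(1,2), of "Suc m"] Suc.prems(3)
    by (simp_all add: z_def d_def at_dist_commute [of _ v u])
  have "at_dist m z v"
    unfolding at_dist_def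
  proof
    show "\<forall>i. \<bar>v $ i - z $ i\<bar> \<le> int m"
    proof
      fix i
      show "\<bar>v $ i - z $ i\<bar> \<le> int m"
        using bound [of i] Suc.hyps by (auto simp: z_def)
    qed
    show "\<exists>i. \<bar>v $ i - z $ i\<bar> = int m"
      using k Suc.hyps by (intro exI [of _ k]) (auto simp: z_def)
  qed
  moreover have "step (int m) z v = d"
    unfolding vec_eq_iff
  proof
    fix i
    show "step (int m) z v $ i = d $ i"
      using bound [of i] Suc.hyps by (auto simp: z_def d_def)
  qed
  ultimately have zd: "z + d \<in> effective_dom f" and ineq: "f (z + d) + f (v - d) \<le> f z + f v"
    using Suc.IH [OF z Suc.prems(2)] by auto
  \<comment> \<open>Where \<open>v - u\<close> is \<open>Suc m\<close>, positive but smaller, 0,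
    negative but above \<open>- Suc m\<close>, or \<open>- Suc m\<close>, \<open>z + d - u\<close>
    is 2, 1, 0, -1, -2. Its half rounds up to \<open>d\<close> and down to
    \<open>z - u\<close>.\<close>
  have ud: "u + d = midpoint_ceil u (z + d)" and z': "z = midpoint_floor u (z + d)"
    unfolding vec_eq_iff
  proof (safe)
    fix i
    show "(u + d) $ i = midpoint_ceil u (z + d) $ i"
      using bound [of i] by (auto simp: z_def d_def)
    show "z $ i = midpoint_floor u (z + d) $ i"
      using bound [of i] by (auto simp: z_def d_def)
  qed
  have close: "\<forall>i. \<bar>u $ i - (z + d) $ i\<bar> \<le> 2" by (simp add: z_def d_def)
  have far: "\<bar>u $ k - (z + d) $ k\<bar> \<ge> 2" using k by (auto simp: z_def d_def)
  have udom: "u + d \<in> effective_dom f"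
    unfolding ud using discrete_midpoint_convex_setD(1) [OF S Suc.prems(1) zd far] .
  have "f (u + d) + f z \<le> f u + f (z + d)"
    using locally_discrete_midpoint_convexD [OF f close far] ud z' by metis
  \<comment> \<open>All six values are finite, so \<open>f z\<close> and \<open>f (z + d)\<close>
    cancel when the two inequalities are added.\<close>
  moreover have "\<bar>f x\<bar> \<noteq> \<infinity>" if "x \<in> effective_dom f" for x
    using that f by (auto simp: effective_dom_def locally_discrete_midpoint_convex_def)
  then obtain a b c e p q where "f u = ereal a" "f v = ereal b" "f z = ereal c"
    "f (z + d) = ereal e" "f (u + d) = ereal p" "f (v - d) = ereal q"
    using Suc.prems(1,2) z zd udom vd by (metis ereal_real')
  ultimately have "f (u + d) + f (v - d) \<le> f u + f v"
    using ineq by simp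
  with udom show ?case by (simp add: d_def)
qed

text \<open>
  The hypothesis on the block \<open>I\<close> is an invariant of the exchange by \<^const>\<open>step\<close>, which turns the
  differences \<open>2, 1, -1, -2\<close> on \<open>I\<close> into \<open>0, -1, -1, -2\<close>; hence \<open>x\<close> is already the rounded-up
  midpoint on \<open>I\<close> once the whole distance is at most one.
\<close>

lemma midpoint_on_block:
  fixes f :: "int ^ 'd::finite \<Rightarrow> ereal"
  assumes f: "locally_discrete_midpoint_convex f"
    and "x \<in> effective_dom f" "y \<in> effective_dom f"
    and "\<forall>i. \<bar>y $ i - x $ i\<bar> \<le> int m"
    and "\<forall>i\<in>I. \<bar>y $ i - x $ i\<bar> \<le> 2"
    and "(\<exists>i. \<bar>y $ i - x $ i\<bar> \<ge> 2) \<or> (\<forall>i\<in>I. y $ i - x $ i \<in> {- 1, 0})"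
  shows "\<exists>p q. f p + f q \<le> f x + f y \<and>
    (\<forall>i\<in>I. p $ i = midpoint_ceil x y $ i \<and> q $ i = midpoint_floor x y $ i)"
  using assms(2-)
proof (induction m arbitrary: x y)
  case 0
  then have "x = y" by (simp add: vec_eq_iff)
  then show ?case by (intro exI [of _ x]) auto
next
  case (Suc m)
  show ?case
  proof (cases "\<forall>i. \<bar>y $ i - x $ i\<bar> \<le> int m")
    case True
    then show ?thesis using Suc.IH Suc.prems by blast
  next
    case False
    then obtain k where k: "\<bar>y $ k - x $ k\<bar> = int (Suc m)"
      using Suc.prems(3) by (metis linorder_not_le of_nat_Suc add.commute zless_add1_eq order_le_less)
    have bound: "\<bar>y $ i - x $ i\<bar> \<le> 1 + int m" for i
      using Suc.prems(3) by simp
    \<comment> \<open>The distance is now exactly \<open>Suc m\<close>: at 1 the pair itself serves,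
      at 2 the local inequality applies, and from 3 on an exchange is made.\<close>
    consider "m = 0" | "m = 1" | "m \<ge> 2" by linarith
    then show ?thesis
    proof cases
      case 1
      have "x $ i = midpoint_ceil x y $ i \<and> y $ i = midpoint_floor x y $ i" if "i \<in> I" for i
      proof -
        have "y $ i - x $ i = - 1 \<or> y $ i = x $ i"
        proof -
          have "\<not> 2 \<le> \<bar>y $ j - x $ j\<bar>" for j using bound [of j] 1 by simp
          then show ?thesis using Suc.prems(5) that by auto
        qed
        then show ?thesis
          by auto
      qed
      then show ?thesis by blast
    next
      case 2
      have "f (midpoint_ceil x y) + f (midpoint_floor x y) \<le> f x + f y"
        using f
      proof (rule locally_discrete_midpoint_convexD)
        show "\<forall>i. \<bar>x $ i - y $ i\<bar> \<le> 2" using bound 2 by (simp add: abs_minus_commute)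
        show "2 \<le> \<bar>x $ k - y $ k\<bar>" using k 2 by simp
      qed
      then show ?thesis by blast
    next
      case 3
      define d where "d = step (int (Suc m)) x y"
      define x' where "x' = x + d"
      define y' where "y' = y - d"
      have S: "discrete_midpoint_convex_set (effective_dom f)"
        using f by (simp add: locally_discrete_midpoint_convex_def)
      have dist: "at_dist (Suc m) x y" using Suc.prems(3) k by (auto simp: at_dist_def)
      have x': "x' \<in> effective_dom f" and le: "f x' + f y' \<le> f x + f y"
        using step_inequality [OF f Suc.prems(1,2) _ dist] by (simp_all add: x'_def y'_def d_def)
      have y': "y' \<in> effective_dom f"
        using diff_step_in_discrete_midpoint_convex_set [OF S Suc.prems(1,2) _ dist]
        by (simp add: y'_def d_def)
      have bound': "\<forall>i. \<bar>y' $ i - x' $ i\<bar> \<le> int m"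
      proof
        fix i
        show "\<bar>y' $ i - x' $ i\<bar> \<le> int m"
          using bound [of i] 3 by (auto simp: x'_def y'_def d_def)
      qed
      \<comment> \<open>Positive differences drop by 2. Negative ones on \<open>I\<close> stay,
        since they are at least -2 while the threshold \<open>- Suc m\<close> is at most -3.\<close>
      have I: "y' $ i - x' $ i \<in> {- 2, - 1, 0}" if "i \<in> I" for i
      proof -
        have "y $ i - x $ i \<in> {- 2, - 1, 0, 1, 2}" using Suc.prems(4) that by force
        then show ?thesis using 3 by (auto simp: x'_def y'_def d_def)
      qed
      have sum: "x' $ i + y' $ i = x $ i + y $ i" for i
        by (simp add: x'_def y'_def)
      have "\<forall>i\<in>I. \<bar>y' $ i - x' $ i\<bar> \<le> 2" using I by fastforce
      moreover have "(\<exists>i. \<bar>y' $ i - x' $ i\<bar> \<ge> 2) \<or> (\<forall>i\<in>I. y' $ i - x' $ i \<in> {- 1, 0})"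
      proof (cases "\<exists>i\<in>I. y' $ i - x' $ i = - 2")
        case True
        then obtain i where "y' $ i - x' $ i = - 2" by blast
        then have "\<bar>y' $ i - x' $ i\<bar> \<ge> 2" by simp
        then show ?thesis by blast
      next
        case False
        then show ?thesis using I by blast
      qed
      ultimately obtain p q where pq: "f p + f q \<le> f x' + f y'"
        "\<forall>i\<in>I. p $ i = midpoint_ceil x' y' $ i \<and> q $ i = midpoint_floor x' y' $ i"
        using Suc.IH [OF x' y' bound'] by blast
      have "f p + f q \<le> f x + f y" using pq(1) le by (rule order_trans)
      then show ?thesis using pq(2) unfolding midpoint_ceil_nth midpoint_floor_nth sum by blast
    qed
  qed
qed

section \<open>Infima and the projection\<close>

text \<open>Carries a bound on all pairs of lifts over to the projection. With
  \<open>-\<infinity>\<close> excluded, an infinite infimum makes the right side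
  \<open>\<infinity>\<close>; finite ones are approximated to within \<open>e / 2\<close>
  each.\<close>

lemma ereal_le_INF_add_INF:
  fixes F :: "'a \<Rightarrow> ereal" and G :: "'b \<Rightarrow> ereal"
  assumes le: "\<And>x y. a \<le> F x + G y"
    and fin: "(INF x. F x) \<noteq> -\<infinity>" "(INF y. G y) \<noteq> -\<infinity>"
  shows "a \<le> (INF x. F x) + (INF y. G y)"
proof (cases "(INF x. F x) = \<infinity> \<or> (INF y. G y) = \<infinity>")
  case True
  then show ?thesis using fin by auto
next
  case False
  then obtain r s where rs: "(INF x. F x) = ereal r" "(INF y. G y) = ereal s"
    using fin by (meson ereal_cases)
  show ?thesis
  proof (rule ereal_le_epsilon2)
    fix e :: real assume "0 < e"
    then have "(INF x. F x) < ereal (r + e / 2)" "(INF y. G y) < ereal (s + e / 2)"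
      by (simp_all add: rs)
    then obtain x y where "F x < ereal (r + e / 2)" "G y < ereal (s + e / 2)"
      by (auto simp: INF_less_iff)
    then have "F x + G y \<le> ereal (r + e / 2) + ereal (s + e / 2)"
      by (intro add_mono) auto
    with le [of x y] show "a \<le> (INF x. F x) + (INF y. G y) + ereal e"
      by (simp add: rs algebra_simps)
  qed
qed

lemma vec_pair_nth [simp]: "vec_pair x y $ Inl i = x $ i" "vec_pair x y $ Inr j = y $ j"
  by (simp_all add: vec_pair_def)

lemma projection_le:
  assumes "\<And>i. p $ Inl i = x $ i"
  shows "projection f x \<le> f p"
proof -
  have "p = vec_pair x (\<chi> j. p $ Inr j)"
    unfolding vec_eq_iff
  proof
    fix k show "p $ k = vec_pair x (\<chi> j. p $ Inr j) $ k"
      using assms by (cases k) auto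
  qed
  then show ?thesis unfolding projection_def by (metis INF_lower UNIV_I)
qed

theorem theorem3p6:
  fixes f :: "int ^ ('n::finite + 'm::finite) \<Rightarrow> ereal"
  assumes "locally_discrete_midpoint_convex f"
    and "\<forall>x. projection f x > -\<infinity>"
  shows "locally_discrete_midpoint_convex (projection f)"
  unfolding locally_discrete_midpoint_convex_def
proof (intro conjI allI impI)
  show "projection f x \<noteq> -\<infinity>" for x using assms(2) by auto
  show "discrete_midpoint_convex_set (effective_dom (projection f))"
    unfolding discrete_midpoint_convex_set_def
  proof (intro ballI impI)
    fix x y
    assume "x \<in> effective_dom (projection f)" "y \<in> effective_dom (projection f)"
      and far: "2 \<le> linf_dist x y"
    then obtain x' y' where xy: "vec_pair x x' \<in> effective_dom f" "vec_pair y y' \<in> effective_dom f"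
      unfolding effective_dom_def projection_def mem_Collect_eq INF_less_iff by blast
    obtain i where "\<bar>x $ i - y $ i\<bar> \<ge> 2" using far linf_dist_ge_2_iff by blast
    then have far': "\<bar>vec_pair x x' $ Inl i - vec_pair y y' $ Inl i\<bar> \<ge> 2" by simp
    have "discrete_midpoint_convex_set (effective_dom f)"
      using assms(1) by (simp add: locally_discrete_midpoint_convex_def)
    note mid = discrete_midpoint_convex_setD [OF this xy far']
    \<comment> \<open>Midpoints are formed coordinatewise, so those of the lifts lie over those of
      \<open>x\<close> and \<open>y\<close>.\<close>
    have "projection f (midpoint_ceil x y) \<le> f (midpoint_ceil (vec_pair x x') (vec_pair y y'))"
      "projection f (midpoint_floor x y) \<le> f (midpoint_floor (vec_pair x x') (vec_pair y y'))"
      by (rule projection_le, simp)+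
    then show "midpoint_ceil x y \<in> effective_dom (projection f) \<and>
        midpoint_floor x y \<in> effective_dom (projection f)"
      using mid by (auto simp: effective_dom_def)
  qed
  fix x y :: "int ^ 'n"
  assume "linf_dist x y = 2"
  then have close: "\<forall>i. \<bar>x $ i - y $ i\<bar> \<le> 2" and "\<exists>i. \<bar>x $ i - y $ i\<bar> \<ge> 2"
    by (simp_all add: linf_dist_eq_2_iff)
  then obtain k where k: "\<bar>x $ k - y $ k\<bar> \<ge> 2" by blast
  have "projection f (midpoint_ceil x y) + projection f (midpoint_floor x y)
      \<le> f (vec_pair x x') + f (vec_pair y y')" for x' y'
  proof (cases "vec_pair x x' \<in> effective_dom f \<and> vec_pair y y' \<in> effective_dom f")
    case False
    then have "f (vec_pair x x') + f (vec_pair y y') = \<infinity>"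
      using assms(1) by (auto simp: effective_dom_def locally_discrete_midpoint_convex_def)
    then show ?thesis by (simp only: ereal_less_eq)
  next
    case True
    define m where "m = (MAX i. nat \<bar>vec_pair y y' $ i - vec_pair x x' $ i\<bar>)"
    have "\<bar>vec_pair y y' $ i - vec_pair x x' $ i\<bar> \<le> int m" for i
    proof -
      have "nat \<bar>vec_pair y y' $ i - vec_pair x x' $ i\<bar> \<le> m" unfolding m_def by (rule Max_ge) auto
      then show ?thesis by simp
    qed
    \<comment> \<open>The coordinate \<open>k\<close> of the first block provides the first
      alternative of the invariant in \<open>midpoint_on_block\<close>.\<close>
    moreover have "\<exists>i. \<bar>vec_pair y y' $ i - vec_pair x x' $ i\<bar> \<ge> 2"
      using k by (intro exI [of _ "Inl k"]) (simp add: abs_minus_commute)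
    moreover have "\<forall>i\<in>range Inl. \<bar>vec_pair y y' $ i - vec_pair x x' $ i\<bar> \<le> 2"
      using close by (auto simp: abs_minus_commute)
    ultimately obtain p q where pq: "f p + f q \<le> f (vec_pair x x') + f (vec_pair y y')"
      "\<forall>i\<in>range Inl. p $ i = midpoint_ceil (vec_pair x x') (vec_pair y y') $ i \<and>
        q $ i = midpoint_floor (vec_pair x x') (vec_pair y y') $ i"
      using midpoint_on_block [OF assms(1), of "vec_pair x x'" "vec_pair y y'" m "range Inl"] True
      by blast
    have "projection f (midpoint_ceil x y) \<le> f p" "projection f (midpoint_floor x y) \<le> f q"
      using pq(2) by (auto intro!: projection_le)
    then have "projection f (midpoint_ceil x y) + projection f (midpoint_floor x y) \<le> f p + f q"
      by (rule add_mono)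
    then show ?thesis using pq(1) by (rule order_trans)
  qed
  then have "projection f (midpoint_ceil x y) + projection f (midpoint_floor x y)
      \<le> (INF x'. f (vec_pair x x')) + (INF y'. f (vec_pair y y'))"
    using assms(2) by (intro ereal_le_INF_add_INF) (auto simp flip: projection_def)
  then show "projection f (midpoint_ceil x y) + projection f (midpoint_floor x y)
      \<le> projection f x + projection f y"
    by (simp add: projection_def)
qed

end
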